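(* Let $r\ge 1$ be a fixed integer and $n=2^r+1$. For each integer $m\ge1$ put $q=2^m$ and let $D_m$ be the $q^2\times q^2$ matrix with rows and columns indexed by $\mathbb{F}_q^2$ whose entry at $x=(x_1,x_2)$, $y=(y_1,y_2)$ is $\left(x_1^{2^r}y_1+x_1y_1^{2^r}+x_2+y_2\right)^{q-1}$. Then the rate $R(D_m)$ converges to $0$ as $m\to\infty$; consequently the generalized BCH family $F_n$ (with $n=2^r+1$) is of unit rate.
   Context: For an $N\times N$ matrix $A$, its rate is $R(A)=\mathrm{rank}(A)/N$. The entries of $D_m$ lie in $\mathbb{F}_2\subseteq\mathbb{F}_q$ and rank is over $\mathbb{F}_2$ (equivalently over $\mathbb{F}_q$). Generalized BCH family: for a fixed odd integer $n>1$ and integers $m\ge1$ with $n\le q-1$, where $q=2^m$, let $S_{n,m}=\{(a,a^n)\mid a\in\mathbb{F}_q\}\subseteq\mathbb{F}_q^2$ and let $\Gamma_{n,m}=\mathrm{Cay}(\mathbb{F}_q^2,S_{n,m}\setminus\{0\})$ be the graph with vertex set $\mathbb{F}_q^2$ in which $x,y$ are adjacent iff $x-y\in S_{n,m}\setminus\{0\}$. Let $C_{n,m}$ be the binary linear code with parity-check matrix $A(\Gamma_{n,m})+I$ over $\mathbb{F}_2$, where $A(\Gamma_{n,m})$ is the adjacency matrix. The family $F_n$ is $\{C_{n,m}\}_m$. The rate of a binary linear code is its dimension divided by its length, and a family is of unit rate if the rates of its codes converge to $1$ as $m\to\infty$. *)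

theory Defs
  imports
    Complex_Main
    "HOL-Algebra.Algebra"
    "HOL-Library.Function_Algebras"
    "HOL-Library.Z2"
    "Graph_Theory.Pair_Digraph"
begin

text \<open>
  A vector indexed by a set \<open>I\<close> is a function vanishing outside \<open>I\<close>, and a matrix with rows and
  columns indexed by \<open>I\<close> is a binary function of which only the values on \<open>I \<times> I\<close> matter.
\<close>

definition fun_scale :: "'k::field \<Rightarrow> ('i \<Rightarrow> 'k) \<Rightarrow> 'i \<Rightarrow> 'k" where
  "fun_scale c f = (\<lambda>i. c * f i)"

interpretation fun_vs: vector_space fun_scale
  by unfold_locales (simp_all add: fun_scale_def fun_eq_iff algebra_simps)

definition mat_column :: "'i set \<Rightarrow> ('i \<Rightarrow> 'i \<Rightarrow> 'k::field) \<Rightarrow> 'i \<Rightarrow> 'i \<Rightarrow> 'k" where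
  "mat_column I A y = (\<lambda>x. if x \<in> I then A x y else 0)"

definition mat_rank :: "'i set \<Rightarrow> ('i \<Rightarrow> 'i \<Rightarrow> 'k::field) \<Rightarrow> nat" where
  "mat_rank I A = fun_vs.dim (mat_column I A ` I)"

definition mat_rate :: "'i set \<Rightarrow> ('i \<Rightarrow> 'i \<Rightarrow> 'k::field) \<Rightarrow> real" where
  "mat_rate I A = real (mat_rank I A) / real (card I)"

definition parity_check_code :: "'i set \<Rightarrow> ('i \<Rightarrow> 'i \<Rightarrow> bit) \<Rightarrow> ('i \<Rightarrow> bit) set" where
  "parity_check_code I H =
     {c. (\<forall>x. x \<notin> I \<longrightarrow> c x = 0) \<and> (\<forall>x\<in>I. (\<Sum>y\<in>I. H x y * c y) = 0)}"

lemma subspace_parity_check_code: "fun_vs.subspace (parity_check_code I H)"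
proof (rule fun_vs.subspaceI)
  show "0 \<in> parity_check_code I H"
    by (simp add: parity_check_code_def)
next
  fix c d assume "c \<in> parity_check_code I H" "d \<in> parity_check_code I H"
  moreover have "(\<Sum>y\<in>I. H x y * (c + d) y) = (\<Sum>y\<in>I. H x y * c y) + (\<Sum>y\<in>I. H x y * d y)" for x
    by (simp only: plus_fun_def distrib_left sum.distrib)
  ultimately show "c + d \<in> parity_check_code I H"
    by (simp only: parity_check_code_def mem_Collect_eq) simp
next
  fix a c assume "c \<in> parity_check_code I H"
  moreover have "(\<Sum>y\<in>I. H x y * fun_scale a c y) = a * (\<Sum>y\<in>I. H x y * c y)" for x
    by (simp only: fun_scale_def sum_distrib_left mult.left_commute)
  ultimately show "fun_scale a c \<in> parity_check_code I H"
    by (simp only: parity_check_code_def mem_Collect_eq) (simp add: fun_scale_def)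
qed

definition code_rate :: "'i set \<Rightarrow> ('i \<Rightarrow> bit) set \<Rightarrow> real" where
  "code_rate I C = real (fun_vs.dim C) / real (card I)"

text \<open>
  The code \<open>C m\<close> has coordinates indexed by \<open>I m\<close>, for \<open>m\<close> in \<open>M\<close>. The limit is taken through \<open>M\<close>
  only, so the notion is vacuous unless \<open>M\<close> is infinite.
\<close>

definition unit_rate_family ::
    "nat set \<Rightarrow> (nat \<Rightarrow> 'i set) \<Rightarrow> (nat \<Rightarrow> ('i \<Rightarrow> bit) set) \<Rightarrow> bool" where
  "unit_rate_family M I C \<longleftrightarrow>
     ((\<lambda>m. code_rate (I m) (C m)) \<longlongrightarrow> 1) (inf sequentially (principal M))"

definition cayley_graph :: "('a, 'b) monoid_scheme \<Rightarrow> 'a set \<Rightarrow> 'a pair_pre_digraph" where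
  "cayley_graph G S =
     \<lparr>pverts = carrier G,
      parcs = {(x, y). x \<in> carrier G \<and> y \<in> carrier G \<and> x \<otimes>\<^bsub>G\<^esub> inv\<^bsub>G\<^esub> y \<in> S}\<rparr>"

lemma pair_graph_cayley_graph:
  assumes "group G" "finite (carrier G)" "\<one>\<^bsub>G\<^esub> \<notin> S"
    and S: "\<And>s. s \<in> S \<Longrightarrow> inv\<^bsub>G\<^esub> s \<in> S"
  shows "pair_graph (cayley_graph G S)"
proof -
  interpret group G by fact
  have fin: "finite (parcs (cayley_graph G S))"
    by (rule finite_subset[of _ "carrier G \<times> carrier G"])
      (use assms(2) in \<open>auto simp: cayley_graph_def\<close>)
  have sym: "y \<otimes>\<^bsub>G\<^esub> inv\<^bsub>G\<^esub> x \<in> S"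
    if "x \<in> carrier G" "y \<in> carrier G" "x \<otimes>\<^bsub>G\<^esub> inv\<^bsub>G\<^esub> y \<in> S" for x y
    using S[OF that(3)] that(1,2) by (simp add: inv_mult_group)
  show ?thesis
    using fin assms(2,3)
    by unfold_locales
      (auto simp: cayley_graph_def symmetric_def arcs_ends_def arc_to_ends_def with_proj_def
        sym_def image_iff intro: sym)
qed

definition adjacency_matrix :: "'a pair_pre_digraph \<Rightarrow> 'a \<Rightarrow> 'a \<Rightarrow> bit" where
  "adjacency_matrix G x y = of_bool ((x, y) \<in> parcs G)"

definition identity_matrix :: "'a \<Rightarrow> 'a \<Rightarrow> bit" where
  "identity_matrix x y = of_bool (x = y)"

text \<open>
  Below, \<open>F\<close> is meant to be a field with \<open>2 ^ m\<close> elements; \<open>order F\<close> plays the role of \<open>q\<close>.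
\<close>

definition plane :: "('a, 'b) ring_scheme \<Rightarrow> ('a \<times> 'a) monoid" where
  "plane F = add_monoid F \<times>\<times> add_monoid F"

lemma carrier_plane [simp]: "carrier (plane F) = carrier F \<times> carrier F"
  by (simp add: plane_def)

definition bch_set :: "('a, 'b) ring_scheme \<Rightarrow> nat \<Rightarrow> ('a \<times> 'a) set" where
  "bch_set F n = {(a, a [^]\<^bsub>F\<^esub> n) | a. a \<in> carrier F}"

definition bch_graph :: "('a, 'b) ring_scheme \<Rightarrow> nat \<Rightarrow> ('a \<times> 'a) pair_pre_digraph" where
  "bch_graph F n = cayley_graph (plane F) (bch_set F n - {\<one>\<^bsub>plane F\<^esub>})"

definition bch_code :: "('a, 'b) ring_scheme \<Rightarrow> nat \<Rightarrow> ('a \<times> 'a \<Rightarrow> bit) set" where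
  "bch_code F n = parity_check_code (carrier (plane F))
     (\<lambda>x y. adjacency_matrix (bch_graph F n) x y + identity_matrix x y)"

definition bch_indices :: "nat \<Rightarrow> nat set" where
  "bch_indices n = {m. 1 \<le> m \<and> n \<le> 2 ^ m - 1}"

definition D_entry :: "('a, 'b) ring_scheme \<Rightarrow> nat \<Rightarrow> 'a \<times> 'a \<Rightarrow> 'a \<times> 'a \<Rightarrow> 'a" where
  "D_entry F r x y =
     (fst x [^]\<^bsub>F\<^esub> (2 ^ r :: nat) \<otimes>\<^bsub>F\<^esub> fst y
        \<oplus>\<^bsub>F\<^esub> fst x \<otimes>\<^bsub>F\<^esub> fst y [^]\<^bsub>F\<^esub> (2 ^ r :: nat)
        \<oplus>\<^bsub>F\<^esub> snd x \<oplus>\<^bsub>F\<^esub> snd y) [^]\<^bsub>F\<^esub> (order F - 1)"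

text \<open>
  The embedding of the two-element field into \<open>F\<close>; through its inverse, entries of a matrix over
  \<open>F\<close> that lie in the prime field are read as bits.
\<close>

definition bit_embed :: "('a, 'b) ring_scheme \<Rightarrow> bit \<Rightarrow> 'a" where
  "bit_embed F b = (if b = 0 then \<zero>\<^bsub>F\<^esub> else \<one>\<^bsub>F\<^esub>)"

definition D_matrix :: "('a, 'b) ring_scheme \<Rightarrow> nat \<Rightarrow> 'a \<times> 'a \<Rightarrow> 'a \<times> 'a \<Rightarrow> bit" where
  "D_matrix F r x y = inv_into UNIV (bit_embed F) (D_entry F r x y)"

lemma bit_embed_D_matrix:
  assumes "field F" "finite (carrier F)" "x \<in> carrier (plane F)" "y \<in> carrier (plane F)"
  shows "bit_embed F (D_matrix F r x y) = D_entry F r x y"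
proof -
  interpret field F by fact
  define t where "t = fst x [^]\<^bsub>F\<^esub> (2 ^ r :: nat) \<otimes>\<^bsub>F\<^esub> fst y
        \<oplus>\<^bsub>F\<^esub> fst x \<otimes>\<^bsub>F\<^esub> fst y [^]\<^bsub>F\<^esub> (2 ^ r :: nat)
        \<oplus>\<^bsub>F\<^esub> snd x \<oplus>\<^bsub>F\<^esub> snd y"
  have t: "t \<in> carrier F"
    using assms(3,4) by (auto simp: t_def)
  have "card {\<zero>\<^bsub>F\<^esub>, \<one>\<^bsub>F\<^esub>} \<le> order F"
    unfolding order_def using assms(2) by (intro card_mono) auto
  then have q: "order F - 1 > 0"
    by simp
  have "t [^]\<^bsub>F\<^esub> (order F - 1) \<in> {\<zero>\<^bsub>F\<^esub>, \<one>\<^bsub>F\<^esub>}"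
  proof (cases "t = \<zero>\<^bsub>F\<^esub>")
    case True
    then show ?thesis
      using q by (simp add: nat_pow_zero)
  next
    case False
    then have u: "t \<in> Units F"
      using t by (simp add: field_Units)
    interpret U: group "units_of F"
      by (rule units_group)
    have "order (units_of F) = order F - 1"
      by (simp add: order_def units_of_carrier field_Units card_Diff_singleton)
    moreover have "t [^]\<^bsub>units_of F\<^esub> order (units_of F) = \<one>\<^bsub>units_of F\<^esub>"
      using u by (intro U.pow_order_eq_1) (simp add: units_of_carrier)
    ultimately show ?thesis
      using u by (simp add: units_of_pow units_of_one)
  qed
  then have "t [^]\<^bsub>F\<^esub> (order F - 1) \<in> range (bit_embed F)"
    by (auto simp: bit_embed_def image_iff intro: exI[of _ 0] exI[of _ 1])
  then show ?thesis
    unfolding D_matrix_def D_entry_def t_def[symmetric] by (rule f_inv_into_f)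
qed

end

theory Submission
  imports Defs "HOL-Real_Asymp.Real_Asymp"
begin

text \<open>
  Since \<open>q - 1 = 1 + 2 + \<dots> + 2 ^ (m - 1)\<close>, the entry of \<open>D\<close> at \<open>(x, y)\<close> is the product over
  \<open>i < m\<close> of the Frobenius conjugates
  \<open>x\<^sub>1 ^ 2 ^ (i + r) y\<^sub>1 ^ 2 ^ i + x\<^sub>1 ^ 2 ^ i y\<^sub>1 ^ 2 ^ (i + r) + x\<^sub>2 ^ 2 ^ i + y\<^sub>2 ^ 2 ^ i\<close>,
  each a sum of four products \<open>f x * g y\<close>. In the product of the conjugates \<open>i\<close> and \<open>i + r\<close> the
  factor \<open>x\<^sub>1 ^ 2 ^ (i + r)\<close> arises in two ways, so that 15 products suffice instead of 16. One such
  pair in each of \<open>m div (2 * r)\<close> disjoint blocks of \<open>2 * r\<close> indices shows that \<open>D\<close> is a sum of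
  at most \<open>4 ^ m * (15 / 16) ^ (m div (2 * r))\<close> products. After the shear
  \<open>x \<mapsto> (x\<^sub>1, x\<^sub>2 + x\<^sub>1 ^ n)\<close> of rows and columns, the parity-check matrix is \<open>1 + D\<close>.
\<close>

section \<open>Dimension, rank and kernel over the two-element field by counting\<close>

lemma card_functions_supported_bit:
  assumes "finite I"
  shows "finite {c :: 'i \<Rightarrow> bit. \<forall>x. x \<notin> I \<longrightarrow> c x = 0}"
    and "card {c :: 'i \<Rightarrow> bit. \<forall>x. x \<notin> I \<longrightarrow> c x = 0} = 2 ^ card I"
proof -
  have "bij_betw (\<lambda>c. {x. c x = 1}) {c :: 'i \<Rightarrow> bit. \<forall>x. x \<notin> I \<longrightarrow> c x = 0} (Pow I)"
    by (rule bij_betw_byWitness[where f' = "\<lambda>S x. of_bool (x \<in> S)"]) (auto simp: fun_eq_iff)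
  then show "finite {c :: 'i \<Rightarrow> bit. \<forall>x. x \<notin> I \<longrightarrow> c x = 0}"
    and "card {c :: 'i \<Rightarrow> bit. \<forall>x. x \<notin> I \<longrightarrow> c x = 0} = 2 ^ card I"
    using assms by (auto simp: bij_betw_finite bij_betw_same_card card_Pow)
qed

text \<open>Coordinates in a basis give a bijection with bit vectors on that basis. Through this
  lemma every statement about dimension or rank below becomes one about cardinalities.\<close>

lemma card_subspace_bit:
  fixes V :: "('i \<Rightarrow> bit) set"
  assumes "finite V" "fun_vs.subspace V"
  shows "card V = 2 ^ fun_vs.dim V"
proof -
  obtain B where B: "B \<subseteq> V" "fun_vs.independent B" "V \<subseteq> fun_vs.span B" "card B = fun_vs.dim V"
    using fun_vs.basis_exists by blast
  have fin: "finite B"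
    using B(1) assms(1) finite_subset by blast
  have V: "V = fun_vs.span B"
    using B(1,3) assms(2) fun_vs.span_minimal by blast
  \<comment> \<open>Coefficient functions are required to vanish off \<open>B\<close>; arbitrary
    values there would destroy injectivity.\<close>
  have inj: "inj_on (\<lambda>u. \<Sum>v\<in>B. fun_scale (u v) v) {u. \<forall>v. v \<notin> B \<longrightarrow> u v = (0 :: bit)}"
  proof (rule inj_onI, rule ext)
    fix u w :: "('i \<Rightarrow> bit) \<Rightarrow> bit" and v
    assume u: "u \<in> {u. \<forall>v. v \<notin> B \<longrightarrow> u v = 0}" "w \<in> {u. \<forall>v. v \<notin> B \<longrightarrow> u v = 0}"
      and eq: "(\<Sum>v\<in>B. fun_scale (u v) v) = (\<Sum>v\<in>B. fun_scale (w v) v)"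
    have "(\<Sum>v\<in>B. fun_scale (u v - w v) v) = 0"
      using eq by (simp only: fun_vs.scale_left_diff_distrib sum_subtractf) simp
    then have "u v - w v = 0" if "v \<in> B"
      using fun_vs.independentD[OF B(2) fin order.refl, of "\<lambda>v. u v - w v"] that by blast
    then show "u v = w v"
      using u by (cases "v \<in> B") auto
  qed
  have "(\<lambda>u. \<Sum>v\<in>B. fun_scale (u v) v) ` {u. \<forall>v. v \<notin> B \<longrightarrow> u v = 0} = V"
  proof (intro equalityI subsetI)
    fix x assume "x \<in> V"
    then obtain u where "x = (\<Sum>v\<in>B. fun_scale (u v) v)"
      using V fun_vs.span_finite[OF fin] by auto
    then have "x = (\<Sum>v\<in>B. fun_scale (if v \<in> B then u v else 0) v)"
      by simp
    then show "x \<in> (\<lambda>u. \<Sum>v\<in>B. fun_scale (u v) v) ` {u. \<forall>v. v \<notin> B \<longrightarrow> u v = 0}"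
      by (intro image_eqI[where x = "\<lambda>v. if v \<in> B then u v else 0"]) auto
  qed (auto simp: V fun_vs.span_finite[OF fin])
  then show ?thesis
    using card_image[OF inj] card_functions_supported_bit(2)[OF fin] B(4) by simp
qed

lemma sum_fun_apply: "(\<Sum>a\<in>A. f a) x = (\<Sum>a\<in>A. f a x)"
  for f :: "'a \<Rightarrow> 'b \<Rightarrow> 'c :: comm_monoid_add"
  by (induction A rule: infinite_finite_induct) auto

lemma column_span_supported:
  "fun_vs.span (mat_column I H ` I) \<subseteq> {c. \<forall>x. x \<notin> I \<longrightarrow> c x = 0}"
proof (rule fun_vs.span_minimal)
  show "mat_column I H ` I \<subseteq> {c. \<forall>x. x \<notin> I \<longrightarrow> c x = 0}"
    by (auto simp: mat_column_def)
  show "fun_vs.subspace {c. \<forall>x. x \<notin> I \<longrightarrow> c x = 0}"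
    by (rule fun_vs.subspaceI) (simp_all add: fun_scale_def)
qed

lemma card_column_span_bit:
  fixes H :: "'i \<Rightarrow> 'i \<Rightarrow> bit"
  assumes "finite I"
  shows "finite (fun_vs.span (mat_column I H ` I))"
    and "card (fun_vs.span (mat_column I H ` I)) = 2 ^ mat_rank I H"
proof -
  show fin: "finite (fun_vs.span (mat_column I H ` I))"
    by (rule finite_subset[OF column_span_supported card_functions_supported_bit(1)[OF assms]])
  show "card (fun_vs.span (mat_column I H ` I)) = 2 ^ mat_rank I H"
    by (subst card_subspace_bit[OF fin fun_vs.subspace_span], subst mat_rank_def,
        subst fun_vs.dim_span) (rule refl)
qed

lemma card_parity_check_code:
  assumes "finite I"
  shows "card (parity_check_code I H) = 2 ^ fun_vs.dim (parity_check_code I H)"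
    and "finite (parity_check_code I H)"
proof -
  show fin: "finite (parity_check_code I H)"
    by (rule finite_subset[OF _ card_functions_supported_bit(1)[OF assms]])
      (auto simp: parity_check_code_def)
  show "card (parity_check_code I H) = 2 ^ fun_vs.dim (parity_check_code I H)"
    by (rule card_subspace_bit[OF fin subspace_parity_check_code])
qed

lemma dim_parity_check_code_le:
  assumes "finite I"
  shows "fun_vs.dim (parity_check_code I H) \<le> card I"
proof -
  have "card (parity_check_code I H) \<le> 2 ^ card I"
    unfolding card_functions_supported_bit(2)[OF assms, symmetric]
    by (rule card_mono[OF card_functions_supported_bit(1)[OF assms]])
      (auto simp: parity_check_code_def)
  then show ?thesis
    by (simp add: card_parity_check_code[OF assms])
qed

text \<open>The rank-nullity inequality by counting: a vector is determined by its image and by its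
  difference from a chosen vector with the same image, and that difference lies in the code.\<close>

lemma dim_parity_check_code_ge:
  fixes H :: "'i \<Rightarrow> 'i \<Rightarrow> bit"
  assumes "finite I"
  shows "card I \<le> fun_vs.dim (parity_check_code I H) + mat_rank I H"
proof -
  define V where "V = {c :: 'i \<Rightarrow> bit. \<forall>x. x \<notin> I \<longrightarrow> c x = 0}"
  define h where "h c = (\<Sum>y\<in>I. fun_scale (c y) (mat_column I H y))" for c
  \<comment> \<open>\<open>h\<close> is multiplication by \<open>H\<close>, and \<open>s\<close>
    chooses one preimage in \<open>V\<close> for each value of \<open>h\<close>.\<close>
  define s where "s = inv_into V h"
  have h: "h c x = (if x \<in> I then \<Sum>y\<in>I. H x y * c y else 0)" for c x
    by (simp add: h_def sum_fun_apply fun_scale_def mat_column_def conj_commute)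
  have span: "h ` V \<subseteq> fun_vs.span (mat_column I H ` I)"
    unfolding h_def
    by (intro image_subsetI fun_vs.span_sum fun_vs.span_scale) (simp add: fun_vs.span_base)
  have s: "s (h c) \<in> V" "h (s (h c)) = h c" if "c \<in> V" for c
    using that by (auto simp: s_def inv_into_into f_inv_into_f)
  have diff: "c - s (h c) \<in> parity_check_code I H" if "c \<in> V" for c
  proof -
    have "h (c - s (h c)) = h c - h (s (h c))"
      by (simp only: h_def minus_apply
          fun_vs.scale_left_diff_distrib sum_subtractf)
    then have "h (c - s (h c)) = 0"
      using s[OF that] by simp
    then have "\<forall>x\<in>I. (\<Sum>y\<in>I. H x y * (c - s (h c)) y) = 0"
      by (metis h zero_fun_def)
    then show ?thesis
      using that s(1)[OF that] by (auto simp: parity_check_code_def V_def)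
  qed
  have "inj_on (\<lambda>c. (c - s (h c), h c)) V"
    by (auto simp: inj_on_def)
  then have "card V \<le> card (parity_check_code I H \<times> fun_vs.span (mat_column I H ` I))"
    using diff span card_parity_check_code(2)[OF assms] card_column_span_bit(1)[OF assms]
    by (intro card_inj_on_le) auto
  then have "(2 :: nat) ^ card I \<le>
      2 ^ (fun_vs.dim (parity_check_code I H) + mat_rank I H)"
    using card_functions_supported_bit(2)[OF assms]
    by (simp add: V_def card_cartesian_product card_parity_check_code[OF assms]
        card_column_span_bit[OF assms] power_add)
  then show ?thesis
    by simp
qed

section \<open>Kernels that are short sums of products\<close>

context cring
begin

text \<open>
  \<open>sep_le I k K\<close>: on \<open>I \<times> I\<close> the kernel \<open>K\<close> is a sum of \<open>k\<close> terms \<open>f x \<otimes> g y\<close>.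
\<close>

primrec sep_le :: "'i set \<Rightarrow> nat \<Rightarrow> ('i \<Rightarrow> 'i \<Rightarrow> 'a) \<Rightarrow> bool" where
  "sep_le I 0 K \<longleftrightarrow> (\<forall>x\<in>I. \<forall>y\<in>I. K x y = \<zero>)"
| "sep_le I (Suc k) K \<longleftrightarrow>
     (\<exists>L f g. sep_le I k L \<and> f \<in> I \<rightarrow> carrier R \<and> g \<in> I \<rightarrow> carrier R \<and>
       (\<forall>x\<in>I. \<forall>y\<in>I. K x y = L x y \<oplus> f x \<otimes> g y))"

declare sep_le.simps(2) [simp del]

lemma sep_le_SucI:
  assumes "sep_le I k L" "f \<in> I \<rightarrow> carrier R" "g \<in> I \<rightarrow> carrier R"
    and "\<And>x y. x \<in> I \<Longrightarrow> y \<in> I \<Longrightarrow> K x y = L x y \<oplus> f x \<otimes> g y"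
  shows "sep_le I (Suc k) K"
  unfolding sep_le.simps using assms by blast

lemma sep_le_SucE:
  assumes "sep_le I (Suc k) K"
  obtains L f g where "sep_le I k L" "f \<in> I \<rightarrow> carrier R" "g \<in> I \<rightarrow> carrier R"
    "\<And>x y. x \<in> I \<Longrightarrow> y \<in> I \<Longrightarrow> K x y = L x y \<oplus> f x \<otimes> g y"
  using assms unfolding sep_le.simps by blast

lemma sep_le_closed:
  assumes "sep_le I k K" "x \<in> I" "y \<in> I"
  shows "K x y \<in> carrier R"
  using assms(1)
proof (induction k arbitrary: K)
  case 0
  then show ?case
    using assms(2,3) by simp
next
  case (Suc k)
  from Suc.prems obtain L f g where L: "sep_le I k L" "f \<in> I \<rightarrow> carrier R"
      "g \<in> I \<rightarrow> carrier R" "\<And>x y. x \<in> I \<Longrightarrow> y \<in> I \<Longrightarrow> K x y = L x y \<oplus> f x \<otimes> g y"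
    by (rule sep_le_SucE) blast
  show ?case
    using L(4)[OF assms(2,3)] Suc.IH[OF L(1)] funcset_mem[OF L(2) assms(2)]
      funcset_mem[OF L(3) assms(3)] by simp
qed

lemma sep_le_cong:
  assumes "sep_le I k K" "\<And>x y. x \<in> I \<Longrightarrow> y \<in> I \<Longrightarrow> L x y = K x y"
  shows "sep_le I k L"
proof (cases k)
  case 0
  then show ?thesis
    using assms by simp
next
  case (Suc l)
  from assms(1)[unfolded Suc] obtain M f g where M: "sep_le I l M" "f \<in> I \<rightarrow> carrier R"
      "g \<in> I \<rightarrow> carrier R" "\<And>x y. x \<in> I \<Longrightarrow> y \<in> I \<Longrightarrow> K x y = M x y \<oplus> f x \<otimes> g y"
    by (rule sep_le_SucE) blast
  show ?thesis
    unfolding Suc by (rule sep_le_SucI[OF M(1-3)]) (simp add: assms(2) M(4))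
qed

lemma sep_le_one:
  assumes f: "f \<in> I \<rightarrow> carrier R" and g: "g \<in> I \<rightarrow> carrier R"
  shows "sep_le I 1 (\<lambda>x y. f x \<otimes> g y)"
  unfolding One_nat_def
  by (rule sep_le_SucI[of I 0 "\<lambda>_ _. \<zero>", OF _ f g])
    (simp_all add: funcset_mem[OF f] funcset_mem[OF g])

lemma sep_le_add:
  assumes "sep_le I k K" "sep_le I l L"
  shows "sep_le I (k + l) (\<lambda>x y. K x y \<oplus> L x y)"
  using assms(2)
proof (induction l arbitrary: L)
  case 0
  have "sep_le I k (\<lambda>x y. K x y \<oplus> L x y)"
    by (rule sep_le_cong[OF assms(1)]) (use 0 sep_le_closed[OF assms(1)] in simp)
  then show ?case
    by simp
next
  case (Suc l)
  from Suc.prems obtain M f g where M: "sep_le I l M" "f \<in> I \<rightarrow> carrier R"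
      "g \<in> I \<rightarrow> carrier R" "\<And>x y. x \<in> I \<Longrightarrow> y \<in> I \<Longrightarrow> L x y = M x y \<oplus> f x \<otimes> g y"
    by (rule sep_le_SucE) blast
  have "sep_le I (Suc (k + l)) (\<lambda>x y. K x y \<oplus> L x y)"
  proof (rule sep_le_SucI[OF Suc.IH[OF M(1)] M(2,3)])
    fix x y assume xy: "x \<in> I" "y \<in> I"
    show "K x y \<oplus> L x y = (K x y \<oplus> M x y) \<oplus> f x \<otimes> g y"
      using sep_le_closed[OF assms(1) xy] sep_le_closed[OF M(1) xy]
        funcset_mem[OF M(2) xy(1)] funcset_mem[OF M(3) xy(2)]
      by (simp add: M(4)[OF xy] a_assoc)
  qed
  then show ?case
    by simp
qed

lemma sep_le_mult_one:
  assumes "sep_le I k K" and f: "f \<in> I \<rightarrow> carrier R" and g: "g \<in> I \<rightarrow> carrier R"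
  shows "sep_le I k (\<lambda>x y. K x y \<otimes> (f x \<otimes> g y))"
  using assms(1)
proof (induction k arbitrary: K)
  case 0
  then show ?case
    by (simp add: funcset_mem[OF f] funcset_mem[OF g])
next
  case (Suc k)
  from Suc.prems obtain M u v where M: "sep_le I k M" and u: "u \<in> I \<rightarrow> carrier R"
      and v: "v \<in> I \<rightarrow> carrier R"
      and K: "\<And>x y. x \<in> I \<Longrightarrow> y \<in> I \<Longrightarrow> K x y = M x y \<oplus> u x \<otimes> v y"
    by (rule sep_le_SucE) blast
  show ?case
  proof (rule sep_le_SucI[OF Suc.IH[OF M]])
    show "(\<lambda>x. u x \<otimes> f x) \<in> I \<rightarrow> carrier R" "(\<lambda>y. v y \<otimes> g y) \<in> I \<rightarrow> carrier R"
      using f g u v by (simp_all add: Pi_iff)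
    fix x y assume xy: "x \<in> I" "y \<in> I"
    show "K x y \<otimes> (f x \<otimes> g y) = M x y \<otimes> (f x \<otimes> g y) \<oplus> (u x \<otimes> f x) \<otimes> (v y \<otimes> g y)"
      using sep_le_closed[OF M xy] funcset_mem[OF f xy(1)] funcset_mem[OF g xy(2)]
        funcset_mem[OF u xy(1)] funcset_mem[OF v xy(2)]
      by (simp add: K[OF xy] l_distr r_distr m_ac)
  qed
qed

lemma sep_le_mult:
  assumes "sep_le I k K" "sep_le I l L"
  shows "sep_le I (k * l) (\<lambda>x y. K x y \<otimes> L x y)"
  using assms(2)
proof (induction l arbitrary: L)
  case 0
  then show ?case
    using sep_le_closed[OF assms(1)] by simp
next
  case (Suc l)
  from Suc.prems obtain M f g where M: "sep_le I l M" "f \<in> I \<rightarrow> carrier R"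
      "g \<in> I \<rightarrow> carrier R" "\<And>x y. x \<in> I \<Longrightarrow> y \<in> I \<Longrightarrow> L x y = M x y \<oplus> f x \<otimes> g y"
    by (rule sep_le_SucE) blast
  have "sep_le I (k * l + k) (\<lambda>x y. K x y \<otimes> L x y)"
  proof (rule sep_le_cong[OF sep_le_add[OF Suc.IH[OF M(1)] sep_le_mult_one[OF assms(1) M(2,3)]]])
    fix x y assume xy: "x \<in> I" "y \<in> I"
    show "K x y \<otimes> L x y = K x y \<otimes> M x y \<oplus> K x y \<otimes> (f x \<otimes> g y)"
      using sep_le_closed[OF assms(1) xy] sep_le_closed[OF M(1) xy]
        funcset_mem[OF M(2) xy(1)] funcset_mem[OF M(3) xy(2)]
      by (simp add: M(4)[OF xy] r_distr)
  qed
  then show ?case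
    by (simp add: add.commute)
qed

text \<open>\<open>W\<close> is the set of \<open>R\<close>-linear combinations of the
  \<open>k\<close> factors in \<open>x\<close>; a column of \<open>K\<close> is such a combination,
  with the factors in \<open>y\<close> as coefficients. Only closure under addition is recorded,
  because the scalars that act later are bits.\<close>

lemma sep_le_finite_additive_set:
  assumes "sep_le I k K" "finite (carrier R)"
  shows "\<exists>W. finite W \<and> card W \<le> order R ^ k \<and> W \<subseteq> I \<rightarrow>\<^sub>E carrier R \<and>
    (\<lambda>x\<in>I. \<zero>) \<in> W \<and> (\<forall>v\<in>W. \<forall>w\<in>W. (\<lambda>x\<in>I. v x \<oplus> w x) \<in> W) \<and>
    (\<forall>y\<in>I. (\<lambda>x\<in>I. K x y) \<in> W)"
  using assms(1)
proof (induction k arbitrary: K)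
  case 0
  then show ?case
    by (intro exI[of _ "{\<lambda>x\<in>I. \<zero>}"]) (auto simp: restrict_def fun_eq_iff)
next
  case (Suc k)
  from Suc.prems obtain M f g where M: "sep_le I k M" "f \<in> I \<rightarrow> carrier R"
      "g \<in> I \<rightarrow> carrier R" "\<And>x y. x \<in> I \<Longrightarrow> y \<in> I \<Longrightarrow> K x y = M x y \<oplus> f x \<otimes> g y"
    by (rule sep_le_SucE) blast
  obtain W where W: "finite W" "card W \<le> order R ^ k" "W \<subseteq> I \<rightarrow>\<^sub>E carrier R"
      "(\<lambda>x\<in>I. \<zero>) \<in> W" "\<And>v w. v \<in> W \<Longrightarrow> w \<in> W \<Longrightarrow> (\<lambda>x\<in>I. v x \<oplus> w x) \<in> W"
      "\<And>y. y \<in> I \<Longrightarrow> (\<lambda>x\<in>I. M x y) \<in> W"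
    using Suc.IH[OF M(1)] by blast
  have f: "f x \<in> carrier R" if "x \<in> I" for x
    using that M(2) by auto
  have Wc: "v x \<in> carrier R" if "v \<in> W" "x \<in> I" for v x
    using that W(3) by auto
  \<comment> \<open>\<open>p\<close> adjoins the multiples of the new factor \<open>f\<close> to
    \<open>W\<close>, which multiplies the size by at most \<open>order R\<close>.\<close>
  define p where "p = (\<lambda>(v, a). \<lambda>x\<in>I. v x \<oplus> f x \<otimes> a)"
  have "card (p ` (W \<times> carrier R)) \<le> card (W \<times> carrier R)"
    using W(1) assms(2) by (intro card_image_le) auto
  also have "\<dots> = card W * order R"
    by (simp add: card_cartesian_product order_def)
  also have "\<dots> \<le> order R ^ Suc k"
    using W(2) by simp
  finally have "card (p ` (W \<times> carrier R)) \<le> order R ^ Suc k" .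
  moreover have "p ` (W \<times> carrier R) \<subseteq> I \<rightarrow>\<^sub>E carrier R"
    using Wc f by (auto simp: p_def)
  moreover have "(\<lambda>x\<in>I. \<zero>) \<in> p ` (W \<times> carrier R)"
    using W(4) f by (intro image_eqI[where x = "(\<lambda>x\<in>I. \<zero>, \<zero>)"])
      (auto simp: p_def restrict_def fun_eq_iff)
  moreover have "(\<lambda>x\<in>I. p (v, a) x \<oplus> p (w, b) x) \<in> p ` (W \<times> carrier R)"
    if "v \<in> W" "w \<in> W" "a \<in> carrier R" "b \<in> carrier R" for v w a b
  proof -
    have "(v x \<oplus> f x \<otimes> a) \<oplus> (w x \<oplus> f x \<otimes> b) = (v x \<oplus> w x) \<oplus> f x \<otimes> (a \<oplus> b)" if "x \<in> I" for x
      using Wc[OF \<open>v \<in> W\<close> that] Wc[OF \<open>w \<in> W\<close> that] f[OF that] \<open>a \<in> carrier R\<close> \<open>b \<in> carrier R\<close>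
      by algebra
    then show ?thesis
      using that W(5) by (intro image_eqI[where x = "(\<lambda>x\<in>I. v x \<oplus> w x, a \<oplus> b)"])
        (auto simp: p_def restrict_def fun_eq_iff)
  qed
  moreover have "(\<lambda>x\<in>I. K x y) \<in> p ` (W \<times> carrier R)" if "y \<in> I" for y
    using that W(6) M(3,4) by (intro image_eqI[where x = "(\<lambda>x\<in>I. M x y, g y)"])
      (auto simp: p_def restrict_def fun_eq_iff)
  moreover have "finite (p ` (W \<times> carrier R))"
    using W(1) assms(2) by blast
  ultimately show ?case
    by (intro exI[of _ "p ` (W \<times> carrier R)"] conjI) blast+
qed

text \<open>Two of the 16 terms of the product share the \<open>x\<close>-factor \<open>a x\<close>, which saves one term.\<close>

lemma sep_le_mult_shared_factor:
  assumes "a \<in> I \<rightarrow> carrier R" "a' \<in> I \<rightarrow> carrier R" "b \<in> I \<rightarrow> carrier R"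
    "b' \<in> I \<rightarrow> carrier R" "c \<in> I \<rightarrow> carrier R" "d \<in> I \<rightarrow> carrier R"
    "e \<in> I \<rightarrow> carrier R" "e' \<in> I \<rightarrow> carrier R" "g' \<in> I \<rightarrow> carrier R"
    "h \<in> I \<rightarrow> carrier R" "k \<in> I \<rightarrow> carrier R"
  shows "sep_le I 15 (\<lambda>x y. (a x \<otimes> a' y \<oplus> b x \<otimes> b' y \<oplus> c x \<oplus> d y) \<otimes>
    (e x \<otimes> e' y \<oplus> a x \<otimes> g' y \<oplus> h x \<oplus> k y))"
proof -
  note cl = assms[THEN funcset_mem]
  \<comment> \<open>The product is cut into three pieces. The terms with \<open>a\<close>,
    \<open>d\<close> times those with \<open>a\<close>, \<open>k\<close> would give four products,
    but \<open>a a' k\<close> and \<open>d a g'\<close> merge into one with \<open>x\<close>-factor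
    \<open>a x\<close>, leaving 3. The terms with \<open>a\<close>, \<open>d\<close> times those
    with \<open>e\<close>, \<open>h\<close> give 4, and those with \<open>b\<close>,
    \<open>c\<close> times the whole second factor give 8. Factors \<open>\<one>\<close> turn terms
    in one variable into products.\<close>
  have s1: "sep_le I (1 + 1 + 1) (\<lambda>x y. a x \<otimes> (a' y \<otimes> k y \<oplus> d y \<otimes> g' y)
      \<oplus> (a x \<otimes> a x) \<otimes> (a' y \<otimes> g' y) \<oplus> \<one> \<otimes> (d y \<otimes> k y))"
    by (intro sep_le_add sep_le_one) (auto simp: cl)
  have s2: "sep_le I ((1 + 1) * (1 + 1)) (\<lambda>x y.
      (a x \<otimes> a' y \<oplus> \<one> \<otimes> d y) \<otimes> (e x \<otimes> e' y \<oplus> h x \<otimes> \<one>))"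
    by (intro sep_le_mult sep_le_add sep_le_one) (auto simp: cl)
  have s3: "sep_le I ((1 + 1) * (1 + 1 + 1 + 1)) (\<lambda>x y.
      (b x \<otimes> b' y \<oplus> c x \<otimes> \<one>) \<otimes>
        (e x \<otimes> e' y \<oplus> a x \<otimes> g' y \<oplus> h x \<otimes> \<one> \<oplus> \<one> \<otimes> k y))"
    by (intro sep_le_mult sep_le_add sep_le_one) (auto simp: cl)
  have num: "(15 :: nat) = (1 + 1 + 1) + (1 + 1) * (1 + 1) + (1 + 1) * (1 + 1 + 1 + 1)"
    by simp
  have *: "sep_le I 15
    (\<lambda>x y. (a x \<otimes> (a' y \<otimes> k y \<oplus> d y \<otimes> g' y)
        \<oplus> (a x \<otimes> a x) \<otimes> (a' y \<otimes> g' y) \<oplus> \<one> \<otimes> (d y \<otimes> k y)) \<oplus>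
      (a x \<otimes> a' y \<oplus> \<one> \<otimes> d y) \<otimes> (e x \<otimes> e' y \<oplus> h x \<otimes> \<one>) \<oplus>
      (b x \<otimes> b' y \<oplus> c x \<otimes> \<one>) \<otimes>
        (e x \<otimes> e' y \<oplus> a x \<otimes> g' y \<oplus> h x \<otimes> \<one> \<oplus> \<one> \<otimes> k y))"
    unfolding num by (rule sep_le_add[OF sep_le_add[OF s1 s2] s3])
  show ?thesis
  proof (rule sep_le_cong[OF *])
    fix x y assume "x \<in> I" "y \<in> I"
    then have cls: "a x \<in> carrier R" "a' y \<in> carrier R" "b x \<in> carrier R" "b' y \<in> carrier R"
      "c x \<in> carrier R" "d y \<in> carrier R" "e x \<in> carrier R" "e' y \<in> carrier R"
      "g' y \<in> carrier R" "h x \<in> carrier R" "k y \<in> carrier R"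
      using assms by (auto simp: Pi_iff)
    have split: "(A \<oplus> B \<oplus> C \<oplus> D) \<otimes> (E \<oplus> G \<oplus> H \<oplus> K) =
        (A \<oplus> D) \<otimes> (G \<oplus> K) \<oplus> (A \<oplus> D) \<otimes> (E \<oplus> H) \<oplus> (B \<oplus> C) \<otimes> (E \<oplus> G \<oplus> H \<oplus> K)"
      if "A \<in> carrier R" "B \<in> carrier R" "C \<in> carrier R" "D \<in> carrier R"
        "E \<in> carrier R" "G \<in> carrier R" "H \<in> carrier R" "K \<in> carrier R" for A B C D E G H K
    proof -
      have regroup: "A \<oplus> B \<oplus> C \<oplus> D = (A \<oplus> D) \<oplus> (B \<oplus> C)"
        "E \<oplus> G \<oplus> H \<oplus> K = (G \<oplus> K) \<oplus> (E \<oplus> H)"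
        using that by (simp_all add: a_ac)
      have "(u \<oplus> v) \<otimes> (z \<oplus> w) = u \<otimes> z \<oplus> u \<otimes> w \<oplus> v \<otimes> (z \<oplus> w)"
        if "u \<in> carrier R" "v \<in> carrier R" "z \<in> carrier R" "w \<in> carrier R" for u v z w
        using that by (simp add: l_distr r_distr a_ac)
      then show ?thesis
        unfolding regroup using that by (meson add.m_closed)
    qed
    have shared: "(a x \<otimes> a' y \<oplus> d y) \<otimes> (a x \<otimes> g' y \<oplus> k y) =
        a x \<otimes> (a' y \<otimes> k y \<oplus> d y \<otimes> g' y) \<oplus> (a x \<otimes> a x) \<otimes> (a' y \<otimes> g' y) \<oplus> d y \<otimes> k y"
      using cls(1,2,6,9,11) by (simp add: l_distr r_distr a_ac m_ac)
    show "(a x \<otimes> a' y \<oplus> b x \<otimes> b' y \<oplus> c x \<oplus> d y) \<otimes>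
        (e x \<otimes> e' y \<oplus> a x \<otimes> g' y \<oplus> h x \<oplus> k y) =
      (a x \<otimes> (a' y \<otimes> k y \<oplus> d y \<otimes> g' y)
        \<oplus> (a x \<otimes> a x) \<otimes> (a' y \<otimes> g' y) \<oplus> \<one> \<otimes> (d y \<otimes> k y)) \<oplus>
      (a x \<otimes> a' y \<oplus> \<one> \<otimes> d y) \<otimes> (e x \<otimes> e' y \<oplus> h x \<otimes> \<one>) \<oplus>
      (b x \<otimes> b' y \<oplus> c x \<otimes> \<one>) \<otimes>
        (e x \<otimes> e' y \<oplus> a x \<otimes> g' y \<oplus> h x \<otimes> \<one> \<oplus> \<one> \<otimes> k y)"
      using cls by (simp add: split shared)
  qed
qed

text \<open>Each factor still depends on one variable only after the substitution. This serves to
  apply the shear to rows and columns at once.\<close>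

lemma sep_le_comp:
  assumes "sep_le I k K" and p: "p \<in> I \<rightarrow> I"
  shows "sep_le I k (\<lambda>x y. K (p x) (p y))"
  using assms(1)
proof (induction k arbitrary: K)
  case 0
  then show ?case
    by (simp add: funcset_mem[OF p])
next
  case (Suc k)
  from Suc.prems obtain M f g where M: "sep_le I k M" "f \<in> I \<rightarrow> carrier R"
      "g \<in> I \<rightarrow> carrier R" "\<And>x y. x \<in> I \<Longrightarrow> y \<in> I \<Longrightarrow> K x y = M x y \<oplus> f x \<otimes> g y"
    by (rule sep_le_SucE) blast
  show ?case
  proof (rule sep_le_SucI[OF Suc.IH[OF M(1)]])
    show "(\<lambda>x. f (p x)) \<in> I \<rightarrow> carrier R" "(\<lambda>y. g (p y)) \<in> I \<rightarrow> carrier R"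
      using M(2,3) p by (simp_all add: Pi_iff)
  qed (simp add: M(4) funcset_mem[OF p])
qed

end

section \<open>Fields with \<open>2 ^ m\<close> elements and the rank bound\<close>

locale binary_field = field R for R (structure) +
  fixes m :: nat
  assumes order_R: "order R = 2 ^ m"
begin

lemma finite_carrier: "finite (carrier R)"
  using order_R by (intro card_ge_0_finite) (simp add: order_def)

lemma order_minus_one_pos: "order R - 1 > 0"
proof -
  have "card {\<zero>, \<one>} \<le> order R"
    unfolding order_def using finite_carrier by (intro card_mono) auto
  then show ?thesis
    by simp
qed

lemma nat_pow_nonzero:
  assumes "x \<in> carrier R" "x \<noteq> \<zero>"
  shows "x [^] (k :: nat) \<noteq> \<zero>"
  by (induction k) (use assms in \<open>simp_all add: integral_iff\<close>)

text \<open>The additive group has order \<open>2 ^ m\<close>, so \<open>2 ^ m\<close> copies of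
  \<open>\<one>\<close> sum to zero. This sum is the \<open>m\<close>-th power of
  \<open>\<one> \<oplus> \<one>\<close>, and a field has no nilpotents except zero.\<close>

lemma one_plus_one: "\<one> \<oplus> \<one> = \<zero>"
proof (rule ccontr)
  assume "\<one> \<oplus> \<one> \<noteq> \<zero>"
  then have nz: "(\<one> \<oplus> \<one>) [^] k \<noteq> \<zero>" for k :: nat
    by (intro nat_pow_nonzero) simp_all
  have "[(2 ^ k :: nat)] \<cdot> \<one> = (\<one> \<oplus> \<one>) [^] k" for k :: nat
  proof (induction k)
    case (Suc k)
    have "[(2 ^ Suc k :: nat)] \<cdot> \<one> = [(2 ^ k :: nat)] \<cdot> \<one> \<oplus> [(2 ^ k :: nat)] \<cdot> \<one>"
      by (simp add: add.nat_pow_mult mult_2)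
    then show ?case
      using Suc by (simp add: r_distr)
  qed simp
  moreover have "[order R] \<cdot> \<one> = \<zero>"
    using add.pow_order_eq_1[of \<one>] by (simp add: order_def add_pow_def)
  ultimately show False
    using nz[of m] order_R by simp
qed

lemma add_self: "x \<in> carrier R \<Longrightarrow> x \<oplus> x = \<zero>"
  using r_distr[of \<one> \<one> x] by (simp add: one_plus_one)

lemma add_eq_zero_iff: "x \<in> carrier R \<Longrightarrow> y \<in> carrier R \<Longrightarrow> x \<oplus> y = \<zero> \<longleftrightarrow> x = y"
  by (metis add_self minus_equality minus_minus)

lemma minus_self: "x \<in> carrier R \<Longrightarrow> \<ominus> x = x"
  by (simp add: add_self minus_equality)

lemma frobenius_add:
  assumes "x \<in> carrier R" "y \<in> carrier R"
  shows "(x \<oplus> y) [^] (2 ^ i :: nat) = x [^] (2 ^ i :: nat) \<oplus> y [^] (2 ^ i :: nat)"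
proof (induction i)
  case 0
  then show ?case
    using assms by simp
next
  case (Suc i)
  have sq: "z [^] (2 ^ Suc i :: nat) = z [^] (2 ^ i :: nat) \<otimes> z [^] (2 ^ i :: nat)"
    if "z \<in> carrier R" for z
    using that by (simp add: nat_pow_mult mult_2)
  define u v where "u = x [^] (2 ^ i :: nat)" and "v = y [^] (2 ^ i :: nat)"
  have uv: "u \<in> carrier R" "v \<in> carrier R"
    using assms by (simp_all add: u_def v_def)
  have "(u \<oplus> v) \<otimes> (u \<oplus> v) = u \<otimes> u \<oplus> v \<otimes> v \<oplus> (u \<otimes> v \<oplus> u \<otimes> v)"
    using uv by (simp add: l_distr r_distr a_ac m_ac)
  then have "(u \<oplus> v) \<otimes> (u \<oplus> v) = u \<otimes> u \<oplus> v \<otimes> v"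
    using uv by (simp add: add_self)
  then show ?case
    using assms Suc by (simp only: sq a_closed u_def v_def)
qed

lemma bit_embed_add: "bit_embed R (a + b) = bit_embed R a \<oplus> bit_embed R b"
  by (cases a; cases b) (simp_all add: bit_embed_def one_plus_one)

lemma bit_embed_inject: "bit_embed R a = bit_embed R b \<longleftrightarrow> a = b"
  by (cases a; cases b) (simp_all add: bit_embed_def)

text \<open>
  Counting replaces the comparison of ranks over the prime field and over \<open>R\<close>: the span over the
  prime field of the columns has \<open>2 ^ rank\<close> elements, all of which lie in an \<open>R\<close>-space with at most
  \<open>(2 ^ m) ^ k\<close> elements. The price is the factor \<open>m\<close>.
\<close>

lemma mat_rank_le_sep:
  fixes H :: "'i \<Rightarrow> 'i \<Rightarrow> bit"
  assumes I: "finite I" and "sep_le I k (\<lambda>x y. bit_embed R (H x y))"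
  shows "mat_rank I H \<le> m * k"
proof -
  obtain W where W: "finite W" "card W \<le> order R ^ k" "(\<lambda>x\<in>I. \<zero>) \<in> W"
      "\<And>v w. v \<in> W \<Longrightarrow> w \<in> W \<Longrightarrow> (\<lambda>x\<in>I. v x \<oplus> w x) \<in> W"
      "\<And>y. y \<in> I \<Longrightarrow> (\<lambda>x\<in>I. bit_embed R (H x y)) \<in> W"
    using sep_le_finite_additive_set[OF assms(2) finite_carrier] by blast
  define e where "e v = (\<lambda>x\<in>I. bit_embed R (v x))" for v :: "'i \<Rightarrow> bit"
  \<comment> \<open>\<open>V\<close> is a subspace over the two-element field, so together with the
    columns it contains their whole span. As its vectors vanish off \<open>I\<close>,
    \<open>e\<close> is injective on it and embeds that span into \<open>W\<close>.\<close>
  define V where "V = {v. (\<forall>x. x \<notin> I \<longrightarrow> v x = 0) \<and> e v \<in> W}"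
  have e0: "e 0 = (\<lambda>x\<in>I. \<zero>)"
    by (simp add: e_def bit_embed_def)
  have e_add: "e (v + w) = (\<lambda>x\<in>I. e v x \<oplus> e w x)" for v w
    unfolding e_def restrict_def plus_fun_def bit_embed_add by (rule ext) simp
  have "fun_vs.subspace V"
  proof (rule fun_vs.subspaceI)
    show "0 \<in> V"
      by (simp add: V_def e0 W(3))
    show "v + w \<in> V" if "v \<in> V" "w \<in> V" for v w
      using that by (simp add: V_def e_add W(4))
    show "fun_scale c v \<in> V" if "v \<in> V" for c v
    proof (cases c)
      case zero
      then have "fun_scale c v = 0"
        by (simp add: fun_scale_def fun_eq_iff)
      with \<open>0 \<in> V\<close> show ?thesis
        by (simp only:)
    next
      case one
      then have "fun_scale c v = v"
        by (simp only: fun_vs.scale_one)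
      then show ?thesis
        using that by simp
    qed
  qed
  moreover have "mat_column I H ` I \<subseteq> V"
  proof
    fix v assume "v \<in> mat_column I H ` I"
    then obtain y where y: "y \<in> I" "v = mat_column I H y"
      by blast
    have "e v = (\<lambda>x\<in>I. bit_embed R (H x y))"
      by (simp add: y(2) e_def mat_column_def restrict_def fun_eq_iff)
    then show "v \<in> V"
      using W(5)[OF y(1)] y(2) by (simp add: V_def mat_column_def)
  qed
  ultimately have span: "fun_vs.span (mat_column I H ` I) \<subseteq> V"
    by (intro fun_vs.span_minimal)
  have "inj_on e V"
  proof (intro inj_onI ext)
    fix v w x assume vw: "v \<in> V" "w \<in> V" "e v = e w"
    then have "e v x = e w x"
      by simp
    then show "v x = w x"
      using vw(1,2) by (cases "x \<in> I") (simp_all add: e_def V_def bit_embed_inject)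
  qed
  then have inj: "inj_on e (fun_vs.span (mat_column I H ` I))"
    using span by (rule inj_on_subset)
  have "e ` V \<subseteq> W"
    by (auto simp: V_def)
  then have "e ` fun_vs.span (mat_column I H ` I) \<subseteq> W"
    using image_mono[OF span] by (rule subset_trans[rotated])
  then have "card (fun_vs.span (mat_column I H ` I)) \<le> card W"
    using W(1) by (rule card_inj_on_le[OF inj])
  also note W(2)
  finally have "2 ^ mat_rank I H \<le> (2 ^ m :: nat) ^ k"
    unfolding card_column_span_bit(2)[OF I] order_R .
  then have "(2 :: nat) ^ mat_rank I H \<le> 2 ^ (m * k)"
    by (simp only: power_mult)
  then show ?thesis
    by simp
qed

section \<open>Decompositions of the powers of the base of \<open>D\<close>\<close>

text \<open>The bracket of \<open>D_entry\<close> without its exponent, so that partial products of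
  its conjugates can be treated as powers with other exponents.\<close>

definition D_base :: "nat \<Rightarrow> 'a \<times> 'a \<Rightarrow> 'a \<times> 'a \<Rightarrow> 'a" where
  "D_base r x y = fst x [^] (2 ^ r :: nat) \<otimes> fst y \<oplus> fst x \<otimes> fst y [^] (2 ^ r :: nat)
     \<oplus> snd x \<oplus> snd y"

abbreviation points :: "('a \<times> 'a) set" where
  "points \<equiv> carrier R \<times> carrier R"

lemma D_entry_eq: "D_entry R r x y = D_base r x y [^] (2 ^ m - 1 :: nat)"
  by (simp add: D_entry_def D_base_def order_R)

lemma D_base_closed: "x \<in> points \<Longrightarrow> y \<in> points \<Longrightarrow> D_base r x y \<in> carrier R"
  by (auto simp: D_base_def)

lemma D_base_frobenius:
  assumes "x \<in> points" "y \<in> points"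
  shows "D_base r x y [^] (2 ^ i :: nat) =
    fst x [^] (2 ^ (i + r) :: nat) \<otimes> fst y [^] (2 ^ i :: nat)
      \<oplus> fst x [^] (2 ^ i :: nat) \<otimes> fst y [^] (2 ^ (i + r) :: nat)
      \<oplus> snd x [^] (2 ^ i :: nat) \<oplus> snd y [^] (2 ^ i :: nat)"
proof -
  have "fst x \<in> carrier R" "fst y \<in> carrier R" "snd x \<in> carrier R" "snd y \<in> carrier R"
    using assms by auto
  then show ?thesis
    by (simp add: D_base_def frobenius_add nat_pow_distrib nat_pow_pow power_add mult.commute)
qed

lemma pow_fst_snd_closed:
  "(\<lambda>x. fst x [^] (k :: nat)) \<in> points \<rightarrow> carrier R"
  "(\<lambda>x. snd x [^] (k :: nat)) \<in> points \<rightarrow> carrier R"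
  by auto

lemma sep_le_D_base_frobenius: "sep_le points 4 (\<lambda>x y. D_base r x y [^] (2 ^ i :: nat))"
proof -
  have one: "(\<lambda>_. \<one>) \<in> points \<rightarrow> carrier R"
    by simp
  note cl = pow_fst_snd_closed
  have num: "(4 :: nat) = 1 + 1 + 1 + 1"
    by simp
  have "sep_le points 4 (\<lambda>x y.
    fst x [^] (2 ^ (i + r) :: nat) \<otimes> fst y [^] (2 ^ i :: nat)
      \<oplus> fst x [^] (2 ^ i :: nat) \<otimes> fst y [^] (2 ^ (i + r) :: nat)
      \<oplus> snd x [^] (2 ^ i :: nat) \<otimes> \<one> \<oplus> \<one> \<otimes> snd y [^] (2 ^ i :: nat))"
    unfolding num
    by (rule sep_le_add[OF sep_le_add[OF sep_le_add[OF sep_le_one[OF cl(1) cl(1)]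
          sep_le_one[OF cl(1) cl(1)]] sep_le_one[OF cl(2) one]] sep_le_one[OF one cl(2)]])
  then show ?thesis
    by (rule sep_le_cong) (auto simp: D_base_frobenius)
qed

text \<open>The shared factor is \<open>fst x\<close> to the power \<open>2 ^ (i + r)\<close>: it
  stands in the first term of conjugate \<open>i\<close> and in the second term of conjugate
  \<open>i + r\<close>. Indices are taken as they stand, not modulo \<open>m\<close>.\<close>

lemma sep_le_D_base_pair:
  "sep_le points 15 (\<lambda>x y. D_base r x y [^] (2 ^ i :: nat) \<otimes> D_base r x y [^] (2 ^ (i + r) :: nat))"
  by (rule sep_le_cong[OF sep_le_mult_shared_factor[where
        a = "\<lambda>x. fst x [^] (2 ^ (i + r) :: nat)" and a' = "\<lambda>y. fst y [^] (2 ^ i :: nat)" and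
        b = "\<lambda>x. fst x [^] (2 ^ i :: nat)" and b' = "\<lambda>y. fst y [^] (2 ^ (i + r) :: nat)" and
        c = "\<lambda>x. snd x [^] (2 ^ i :: nat)" and d = "\<lambda>y. snd y [^] (2 ^ i :: nat)" and
        e = "\<lambda>x. fst x [^] (2 ^ (i + r + r) :: nat)" and
        e' = "\<lambda>y. fst y [^] (2 ^ (i + r) :: nat)" and
        g' = "\<lambda>y. fst y [^] (2 ^ (i + r + r) :: nat)" and
        h = "\<lambda>x. snd x [^] (2 ^ (i + r) :: nat)" and
        k = "\<lambda>y. snd y [^] (2 ^ (i + r) :: nat)",
        OF pow_fst_snd_closed(1) pow_fst_snd_closed(1) pow_fst_snd_closed(1)
          pow_fst_snd_closed(1) pow_fst_snd_closed(2) pow_fst_snd_closed(2)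
          pow_fst_snd_closed(1) pow_fst_snd_closed(1) pow_fst_snd_closed(1)
          pow_fst_snd_closed(2) pow_fst_snd_closed(2)]])
    (simp only: D_base_frobenius)

text \<open>Exponents add while numbers of terms multiply. The lemmas that follow therefore amount
  to splitting an exponent by its binary digits.\<close>

lemma sep_le_D_base_add:
  assumes "sep_le points k (\<lambda>x y. D_base r x y [^] (i :: nat))"
    and "sep_le points l (\<lambda>x y. D_base r x y [^] (j :: nat))"
  shows "sep_le points (k * l) (\<lambda>x y. D_base r x y [^] (i + j))"
  by (rule sep_le_cong[OF sep_le_mult[OF assms]]) (simp only: nat_pow_mult D_base_closed)

lemma sep_le_D_base_zero: "sep_le points 1 (\<lambda>x y. D_base r x y [^] (0 :: nat))"
  by (rule sep_le_cong[OF sep_le_one[of "\<lambda>_. \<one>" _ "\<lambda>_. \<one>"]]) simp_all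

text \<open>The exponent has ones exactly at the \<open>k\<close> binary digits from
  \<open>i\<close> on, and each digit is one conjugate with 4 terms.\<close>

lemma sep_le_D_base_geometric:
  "sep_le points (4 ^ k) (\<lambda>x y. D_base r x y [^] (2 ^ i * (2 ^ k - 1) :: nat))"
proof (induction k)
  case 0
  then show ?case
    using sep_le_D_base_zero by simp
next
  case (Suc k)
  have "(2 ^ i * (2 ^ k - 1) + 2 ^ (i + k) :: nat) = 2 ^ i * (2 ^ Suc k - 1)"
    by (simp add: power_add algebra_simps)
  then show ?case
    using sep_le_D_base_add[OF Suc sep_le_D_base_frobenius[of r "i + k"]]
    by (simp only: power_Suc2)
qed

text \<open>The exponent has ones at the \<open>2 * r\<close> digits from \<open>i\<close> on.
  Digits \<open>i\<close> and \<open>i + r\<close> form the pair with 15 terms; behind each of them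
  follows a run of \<open>s = r - 1\<close> digits with 4 terms each.\<close>

lemma sep_le_D_base_block:
  assumes "r = Suc s"
  shows "sep_le points (15 * 4 ^ (2 * s)) (\<lambda>x y. D_base r x y [^] (2 ^ i * (2 ^ (2 * r) - 1) :: nat))"
proof -
  have pair: "sep_le points 15 (\<lambda>x y. D_base r x y [^] (2 ^ i + 2 ^ (i + r) :: nat))"
    by (rule sep_le_cong[OF sep_le_D_base_pair[of r i]]) (simp only: nat_pow_mult D_base_closed)
  have "(2 ^ i + 2 ^ (i + r) + 2 ^ (i + 1) * (2 ^ s - 1) + 2 ^ (i + r + 1) * (2 ^ s - 1) :: nat) =
      2 ^ i * (2 ^ (2 * r) - 1)"
  proof -
    \<comment> \<open>Writing \<open>2 ^ s\<close> as \<open>Suc u\<close> removes the truncated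
      subtractions and leaves a polynomial identity in \<open>u\<close>.\<close>
    obtain u where u: "(2 :: nat) ^ s = Suc u"
      by (metis gr0_implies_Suc pos2 zero_less_power)
    have r: "(2 :: nat) ^ r = 2 * Suc u"
      by (simp add: assms u)
    have "(2 :: nat) ^ (2 * r) = (2 * Suc u) * (2 * Suc u)"
      by (simp only: mult_2[of r] power_add r)
    then have rr: "(2 :: nat) ^ (2 * r) - 1 = 4 * u * u + 8 * u + 3"
      by (simp add: algebra_simps)
    show ?thesis
      by (simp only: power_add power_one_right rr r u diff_Suc_1) (simp add: algebra_simps)
  qed
  moreover have "(15 * 4 ^ s * 4 ^ s :: nat) = 15 * 4 ^ (2 * s)"
    by (simp add: mult_2 power_add)
  ultimately show ?thesis
    using sep_le_D_base_add[OF sep_le_D_base_add[OF pair sep_le_D_base_geometric[of s r "i + 1"]]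
        sep_le_D_base_geometric[of s r "i + r + 1"]]
    by (simp only:)
qed

lemma sep_le_D_base_blocks:
  assumes "r = Suc s"
  shows "sep_le points ((15 * 4 ^ (2 * s)) ^ a) (\<lambda>x y. D_base r x y [^] (2 ^ (2 * r * a) - 1 :: nat))"
proof (induction a)
  case 0
  then show ?case
    using sep_le_D_base_zero by simp
next
  case (Suc a)
  \<comment> \<open>The digits below \<open>2 * r * a\<close>, followed by one more block starting
    at digit \<open>2 * r * a\<close>.\<close>
  have "(2 ^ (2 * r * a) - 1 + 2 ^ (2 * r * a) * (2 ^ (2 * r) - 1) :: nat) =
      2 ^ (2 * r * Suc a) - 1"
    by (simp add: power_add diff_mult_distrib2 mult.commute)
  then show ?case
    using sep_le_D_base_add[OF Suc sep_le_D_base_block[OF assms, of "2 * r * a"]]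
    by (simp only: power_Suc2)
qed

text \<open>One factor for each full block of \<open>2 * r\<close> digits among the \<open>m\<close>
  ones of \<open>q - 1\<close>, and a factor 4 for each digit left over.\<close>

definition sep_bound :: "nat \<Rightarrow> nat" where
  "sep_bound r = (15 * 4 ^ (2 * (r - 1))) ^ (m div (2 * r)) * 4 ^ (m mod (2 * r))"

text \<open>A block without the saving would cost \<open>4 ^ (2 * r)\<close>, which is 16/15 of its
  actual cost. Since \<open>4 ^ m\<close> is the number of points, the remaining factor is what
  bounds the rate.\<close>

lemma sep_bound_eq:
  assumes "r \<ge> 1"
  shows "real (sep_bound r) = 4 ^ m * (15 / 16) ^ (m div (2 * r))"
proof -
  define a b where "a = m div (2 * r)" and "b = m mod (2 * r)"
  obtain s where s: "r = Suc s"
    using assms by (metis Suc_le_D One_nat_def)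
  have m: "m = 2 * r * a + b"
    by (simp add: a_def b_def)
  have "real (sep_bound r) = (15 * 4 ^ (2 * (r - 1))) ^ a * 4 ^ b"
    by (simp only: sep_bound_def a_def b_def of_nat_mult of_nat_power of_nat_numeral)
  also have "(15 * 4 ^ (2 * (r - 1)) :: real) = 4 ^ (2 * r) * (15 / 16)"
    by (simp add: s)
  also have "(4 ^ (2 * r) * (15 / 16)) ^ a * 4 ^ b = (4 :: real) ^ (2 * r * a + b) * (15 / 16) ^ a"
    unfolding power_mult_distrib power_mult[of 4 "2 * r" a, symmetric] power_add
    by (simp only: mult.assoc mult.commute[of "4 ^ b"])
  finally show ?thesis
    unfolding m[symmetric] unfolding a_def .
qed

lemma sep_le_D_entry:
  assumes "r \<ge> 1"
  shows "sep_le points (sep_bound r) (D_entry R r)"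
proof -
  define a b where "a = m div (2 * r)" and "b = m mod (2 * r)"
  obtain s where s: "r = Suc s"
    using assms by (metis Suc_le_D One_nat_def)
  have m: "m = 2 * r * a + b"
    by (simp add: a_def b_def)
  \<comment> \<open>The lower \<open>2 * r * a\<close> digits of \<open>q - 1\<close> are covered by
    blocks, the top \<open>b\<close> digits one at a time.\<close>
  have "(2 ^ (2 * r * a) - 1 + 2 ^ (2 * r * a) * (2 ^ b - 1) :: nat) = 2 ^ m - 1"
    unfolding m by (simp add: power_add diff_mult_distrib2)
  moreover have "sep_bound r = (15 * 4 ^ (2 * s)) ^ a * 4 ^ b"
    by (simp add: sep_bound_def a_def b_def s)
  ultimately have "sep_le points (sep_bound r) (\<lambda>x y. D_base r x y [^] (2 ^ m - 1 :: nat))"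
    using sep_le_D_base_add[OF sep_le_D_base_blocks[OF s] sep_le_D_base_geometric[of b r "2 * r * a"],
        of a]
    by (simp only:)
  then show ?thesis
    by (rule sep_le_cong) (simp only: D_entry_eq)
qed

lemma mat_rank_D_matrix_le:
  assumes "r \<ge> 1"
  shows "mat_rank (carrier (plane R)) (D_matrix R r) \<le> m * sep_bound r"
proof (rule mat_rank_le_sep)
  show "finite (carrier (plane R))"
    using finite_carrier by simp
  show "sep_le (carrier (plane R)) (sep_bound r) (\<lambda>x y. bit_embed R (D_matrix R r x y))"
    unfolding carrier_plane
    by (rule sep_le_cong[OF sep_le_D_entry[OF assms]])
      (simp add: bit_embed_D_matrix[OF field_axioms finite_carrier])
qed

lemma D_entry_cases:
  assumes "x \<in> points" "y \<in> points"
  shows "D_entry R r x y = (if D_base r x y = \<zero> then \<zero> else \<one>)"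
proof (cases "D_base r x y = \<zero>")
  case True
  then show ?thesis
    \<comment> \<open>Positivity of \<open>q - 1\<close> matters here, because the zeroth power of
      \<open>\<zero>\<close> is \<open>\<one>\<close>.\<close>
    using order_minus_one_pos order_R by (simp add: D_entry_eq nat_pow_zero)
next
  case False
  then have "D_entry R r x y \<noteq> \<zero>"
    unfolding D_entry_eq using D_base_closed[OF assms] by (intro nat_pow_nonzero)
  \<comment> \<open>The entry is known to be \<open>\<zero>\<close> or \<open>\<one>\<close>, so
    being nonzero settles it.\<close>
  moreover have "D_entry R r x y = bit_embed R (D_matrix R r x y)"
    using bit_embed_D_matrix[OF field_axioms finite_carrier] assms by simp
  ultimately show ?thesis
    using False by (simp add: bit_embed_def split: if_splits)
qed

section \<open>The parity-check matrix as a sheared copy of \<open>1 + D\<close>\<close>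

definition shear :: "nat \<Rightarrow> 'a \<times> 'a \<Rightarrow> 'a \<times> 'a" where
  "shear r x = (fst x, snd x \<oplus> fst x [^] (2 ^ r + 1 :: nat))"

lemma shear_closed: "shear r \<in> points \<rightarrow> points"
  by (auto simp: shear_def)

text \<open>By additivity of Frobenius, the power \<open>2 ^ r + 1\<close> of
  \<open>fst x \<oplus> fst y\<close> consists of the two mixed terms of \<open>D_base\<close> and
  of the two pure powers, which the shear contributes.\<close>

lemma D_base_shear:
  assumes "x \<in> points" "y \<in> points"
  shows "D_base r (shear r x) (shear r y) =
    (snd x \<oplus> snd y) \<oplus> (fst x \<oplus> fst y) [^] (2 ^ r + 1 :: nat)"
proof -
  have cl: "fst x \<in> carrier R" "fst y \<in> carrier R" "snd x \<in> carrier R" "snd y \<in> carrier R"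
    using assms by auto
  define a b where "a = fst x [^] (2 ^ r :: nat)" and "b = fst y [^] (2 ^ r :: nat)"
  have ab: "a \<in> carrier R" "b \<in> carrier R"
    using cl by (simp_all add: a_def b_def)
  have "(fst x \<oplus> fst y) [^] (2 ^ r + 1 :: nat) = (a \<oplus> b) \<otimes> (fst x \<oplus> fst y)"
    using cl by (simp add: frobenius_add a_def b_def)
  moreover have "D_base r (shear r x) (shear r y) =
      a \<otimes> fst y \<oplus> fst x \<otimes> b \<oplus> (snd x \<oplus> a \<otimes> fst x) \<oplus> (snd y \<oplus> b \<otimes> fst y)"
    by (simp add: D_base_def shear_def a_def b_def)
  ultimately show ?thesis
    using cl ab by (simp add: l_distr r_distr a_ac m_ac)
qed

lemma plane_div:
  assumes "x \<in> points" "y \<in> points"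
  shows "x \<otimes>\<^bsub>plane R\<^esub> inv\<^bsub>plane R\<^esub> y = (fst x \<oplus> fst y, snd x \<oplus> snd y)"
proof -
  obtain a b c d where xy: "x = (a, b)" "y = (c, d)"
      "a \<in> carrier R" "b \<in> carrier R" "c \<in> carrier R" "d \<in> carrier R"
    using assms by auto
  have "inv\<^bsub>plane R\<^esub> (c, d) = (inv\<^bsub>add_monoid R\<^esub> c, inv\<^bsub>add_monoid R\<^esub> d)"
    unfolding plane_def using xy by (intro inv_DirProd add.group_axioms) simp_all
  also have "\<dots> = (c, d)"
    using minus_self[of c] minus_self[of d] xy by (simp add: a_inv_def)
  finally show ?thesis
    by (simp add: xy plane_def DirProd_def)
qed

lemma bch_arc_iff:
  assumes "x \<in> points" "y \<in> points"
  shows "(x, y) \<in> parcs (bch_graph R n) \<longleftrightarrow>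
    snd x \<oplus> snd y = (fst x \<oplus> fst y) [^] n \<and> x \<noteq> y"
proof -
  have cl: "fst x \<in> carrier R" "fst y \<in> carrier R" "snd x \<in> carrier R" "snd y \<in> carrier R"
    using assms by auto
  have one: "\<one>\<^bsub>plane R\<^esub> = (\<zero>, \<zero>)"
    by (simp add: plane_def DirProd_def)
  have S: "(u, v) \<in> bch_set R n \<longleftrightarrow> v = u [^] n" if "u \<in> carrier R" for u v
    using that by (auto simp: bch_set_def)
  have eq: "x = y \<longleftrightarrow> fst x \<oplus> fst y = \<zero> \<and> snd x \<oplus> snd y = \<zero>"
    using cl by (simp add: add_eq_zero_iff prod_eq_iff)
  show ?thesis
    using assms cl by (simp add: bch_graph_def cayley_graph_def plane_div one S eq)
qed

text \<open>Adding the identity matrix restores the diagonal lost by removing the identity from the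
  connection set. The entry is then 1 exactly when the difference of the points lies in
  \<open>bch_set\<close>, that is, when the sheared \<open>D_base\<close> vanishes, and exactly
  there the sheared \<open>D\<close> is zero.\<close>

lemma bch_parity_check_eq:
  assumes "x \<in> points" "y \<in> points"
  shows "bit_embed R (adjacency_matrix (bch_graph R (2 ^ r + 1)) x y + identity_matrix x y) =
    \<one> \<oplus> D_entry R r (shear r x) (shear r y)"
proof -
  have cl: "fst x \<in> carrier R" "fst y \<in> carrier R" "snd x \<in> carrier R" "snd y \<in> carrier R"
    using assms by auto
  \<comment> \<open>On the diagonal both sides are zero; \<open>n > 0\<close> excludes the zeroth
    power of \<open>\<zero>\<close>.\<close>
  have loop: "snd x \<oplus> snd y = (fst x \<oplus> fst y) [^] n" if "x = y" "n > 0" for n :: nat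
    using cl that by (simp add: add_self nat_pow_zero)
  have parity: "adjacency_matrix (bch_graph R n) x y + identity_matrix x y =
      of_bool (snd x \<oplus> snd y = (fst x \<oplus> fst y) [^] n)" if "n > 0" for n :: nat
    using loop that assms
    by (cases "x = y") (simp_all add: adjacency_matrix_def identity_matrix_def bch_arc_iff)
  have "adjacency_matrix (bch_graph R (2 ^ r + 1)) x y + identity_matrix x y =
      of_bool (snd x \<oplus> snd y = (fst x \<oplus> fst y) [^] (2 ^ r + 1 :: nat))"
    by (rule parity) simp
  also have "\<dots> = of_bool (D_base r (shear r x) (shear r y) = \<zero>)"
    using cl by (simp only: D_base_shear[OF assms] add_eq_zero_iff a_closed nat_pow_closed)
  finally show ?thesis
    using D_entry_cases[OF funcset_mem[OF shear_closed assms(1)] funcset_mem[OF shear_closed assms(2)]]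
    by (simp add: bit_embed_def one_plus_one)
qed

text \<open>The all-ones kernel costs one product more than \<open>D\<close>, and the shear costs
  none.\<close>

lemma mat_rank_bch_le:
  assumes "r \<ge> 1"
  shows "mat_rank (carrier (plane R))
      (\<lambda>x y. adjacency_matrix (bch_graph R (2 ^ r + 1)) x y + identity_matrix x y)
    \<le> m * (1 + sep_bound r)"
proof (rule mat_rank_le_sep)
  show "finite (carrier (plane R))"
    using finite_carrier by simp
  have one: "(\<lambda>_. \<one>) \<in> points \<rightarrow> carrier R"
    by simp
  have "sep_le points (1 + sep_bound r)
      (\<lambda>x y. \<one> \<otimes> \<one> \<oplus> D_entry R r (shear r x) (shear r y))"
    by (rule sep_le_add[OF sep_le_one[OF one one] sep_le_comp[OF sep_le_D_entry[OF assms] shear_closed]])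
  then show "sep_le (carrier (plane R)) (1 + sep_bound r)
      (\<lambda>x y. bit_embed R (adjacency_matrix (bch_graph R (2 ^ r + 1)) x y + identity_matrix x y))"
    unfolding carrier_plane by (rule sep_le_cong) (simp only: bch_parity_check_eq l_one one_closed)
qed

section \<open>Explicit bounds on the rates\<close>

lemma card_points: "card points = 4 ^ m"
proof -
  have "card (carrier R) = 2 ^ m"
    using order_R by (simp add: order_def)
  then show ?thesis
    by (simp add: card_cartesian_product power_mult_distrib[symmetric])
qed

lemma mat_rate_D_matrix_le:
  assumes "r \<ge> 1"
  shows "mat_rate (carrier (plane R)) (D_matrix R r) \<le> real m * (15 / 16) ^ (m div (2 * r))"
proof -
  define c :: real where "c = (15 / 16) ^ (m div (2 * r))"
  have "real (mat_rank points (D_matrix R r)) \<le> real (m * sep_bound r)"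
    using mat_rank_D_matrix_le[OF assms] by (simp only: of_nat_le_iff carrier_plane)
  then have "real (mat_rank points (D_matrix R r)) \<le> real m * (4 ^ m * c)"
    by (simp only: of_nat_mult sep_bound_eq[OF assms] c_def)
  then have "real (mat_rank points (D_matrix R r)) / 4 ^ m \<le> real m * (4 ^ m * c) / 4 ^ m"
    by (rule divide_right_mono) simp
  also have "\<dots> = real m * c"
    by simp
  finally show ?thesis
    unfolding mat_rate_def carrier_plane card_points c_def[symmetric] of_nat_power of_nat_numeral .
qed

text \<open>The lower bound is one minus the rank bound divided by \<open>4 ^ m\<close>:
  \<open>m / 4 ^ m\<close> stems from the all-ones kernel, the other term from
  \<open>D\<close>.\<close>

lemma code_rate_bch_bounds:
  assumes "r \<ge> 1"
  shows "code_rate (carrier (plane R)) (bch_code R (2 ^ r + 1)) \<le> 1"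
    and "code_rate (carrier (plane R)) (bch_code R (2 ^ r + 1))
      \<ge> 1 - (real m / 4 ^ m + real m * (15 / 16) ^ (m div (2 * r)))"
proof -
  define c :: real where "c = (15 / 16) ^ (m div (2 * r))"
  define d where "d = fun_vs.dim (bch_code R (2 ^ r + 1))"
  have fin: "finite points"
    using finite_carrier by simp
  have rate: "code_rate (carrier (plane R)) (bch_code R (2 ^ r + 1)) = real d / 4 ^ m"
    unfolding code_rate_def carrier_plane card_points d_def of_nat_power of_nat_numeral ..
  have "d \<le> 4 ^ m"
    unfolding d_def bch_code_def carrier_plane card_points[symmetric]
    by (rule dim_parity_check_code_le[OF fin])
  then have "real d \<le> real (4 ^ m)"
    by (simp only: of_nat_le_iff)
  then show "code_rate (carrier (plane R)) (bch_code R (2 ^ r + 1)) \<le> 1"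
    unfolding rate by simp
  have "4 ^ m \<le> d + m * (1 + sep_bound r)"
    unfolding d_def bch_code_def carrier_plane card_points[symmetric]
    by (rule order_trans[OF dim_parity_check_code_ge[OF fin]
          add_left_mono[OF mat_rank_bch_le[OF assms, unfolded carrier_plane]]])
  then have "real (4 ^ m) \<le> real (d + m * (1 + sep_bound r))"
    by (simp only: of_nat_le_iff)
  also have "\<dots> = real d + real m * (1 + 4 ^ m * c)"
    by (simp only: of_nat_add of_nat_mult of_nat_1 sep_bound_eq[OF assms] c_def)
  finally have "4 ^ m - real m * (1 + 4 ^ m * c) \<le> real d"
    by simp
  then have "(4 ^ m - real m * (1 + 4 ^ m * c)) / 4 ^ m \<le> real d / 4 ^ m"
    by (rule divide_right_mono) simp
  moreover have "(4 ^ m - real m * (1 + 4 ^ m * c)) / 4 ^ m = 1 - (real m / 4 ^ m + real m * c)"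
    by (simp add: field_simps)
  ultimately show "code_rate (carrier (plane R)) (bch_code R (2 ^ r + 1))
      \<ge> 1 - (real m / 4 ^ m + real m * (15 / 16) ^ (m div (2 * r)))"
    unfolding rate c_def by simp
qed

end

section \<open>Passage to the limit\<close>

lemma tendsto_linear_times_power_div:
  fixes p :: nat
  assumes "p > 0"
  shows "((\<lambda>k. real k * (15 / 16) ^ (k div p)) \<longlongrightarrow> 0) sequentially"
proof (rule tendsto_sandwich[OF _ _ tendsto_const])
  show "\<forall>\<^sub>F k in sequentially. 0 \<le> real k * (15 / 16) ^ (k div p)"
    by simp
  \<comment> \<open>Bounding \<open>k\<close> linearly in \<open>k div p\<close> makes the majorant
    a function of \<open>k div p\<close> alone, which tends to infinity with
    \<open>k\<close>.\<close>
  have "real k \<le> real p * (real (k div p) + 1)" for k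
  proof -
    have "k \<le> p * (k div p + 1)"
      using assms by (simp add: less_imp_le dividend_less_times_div)
    then have "real k \<le> real (p * (k div p + 1))"
      by (simp only: of_nat_le_iff)
    then show ?thesis
      by (simp add: algebra_simps)
  qed
  then show "\<forall>\<^sub>F k in sequentially. real k * (15 / 16) ^ (k div p)
      \<le> real p * (real (k div p) + 1) * (15 / 16) ^ (k div p)"
    by (intro always_eventually allI mult_right_mono) simp_all
  have "((\<lambda>a. real p * (real a + 1) * (15 / 16) ^ a) \<longlongrightarrow> 0) sequentially"
    by real_asymp
  then show "((\<lambda>k. real p * (real (k div p) + 1) * (15 / 16) ^ (k div p)) \<longlongrightarrow> 0) sequentially"
    by (rule filterlim_compose) (rule filterlim_at_top_div_const_nat[OF assms])
qed

theorem corollary16: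
  fixes r n :: nat and F :: "nat \<Rightarrow> 'a ring"
  assumes "r \<ge> 1" and "n = 2 ^ r + 1"
    and "\<And>m. m \<ge> 1 \<Longrightarrow> field (F m)"
    and "\<And>m. m \<ge> 1 \<Longrightarrow> order (F m) = 2 ^ m"
  shows "(\<lambda>m. mat_rate (carrier (plane (F m))) (D_matrix (F m) r)) \<longlonglongrightarrow> 0 \<and>
         unit_rate_family (bch_indices n)
           (\<lambda>m. carrier (plane (F m))) (\<lambda>m. bch_code (F m) n)"
proof
  have F: "binary_field (F m) m" if "m \<ge> 1" for m
    using assms(3,4)[OF that] by (simp add: binary_field_def binary_field_axioms_def)
  have lim: "((\<lambda>m. real m * (15 / 16) ^ (m div (2 * r))) \<longlongrightarrow> 0) sequentially"
    using assms(1) by (intro tendsto_linear_times_power_div) simp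
  show "((\<lambda>m. mat_rate (carrier (plane (F m))) (D_matrix (F m) r)) \<longlongrightarrow> 0) sequentially"
  proof (rule tendsto_sandwich[OF _ _ tendsto_const lim])
    show "\<forall>\<^sub>F m in sequentially. 0 \<le> mat_rate (carrier (plane (F m))) (D_matrix (F m) r)"
      by (simp add: mat_rate_def)
    show "\<forall>\<^sub>F m in sequentially. mat_rate (carrier (plane (F m))) (D_matrix (F m) r)
        \<le> real m * (15 / 16) ^ (m div (2 * r))"
      using eventually_ge_at_top[of 1]
      by eventually_elim (rule binary_field.mat_rate_D_matrix_le[OF F assms(1)])
  qed
  have "((\<lambda>m. code_rate (carrier (plane (F m))) (bch_code (F m) n)) \<longlongrightarrow> 1) sequentially"
  proof (rule tendsto_sandwich[OF _ _ _ tendsto_const])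
    show "\<forall>\<^sub>F m in sequentially. 1 - (real m / 4 ^ m + real m * (15 / 16) ^ (m div (2 * r)))
        \<le> code_rate (carrier (plane (F m))) (bch_code (F m) n)"
      using eventually_ge_at_top[of 1] unfolding assms(2)
      by eventually_elim (rule binary_field.code_rate_bch_bounds(2)[OF F assms(1)])
    show "\<forall>\<^sub>F m in sequentially. code_rate (carrier (plane (F m))) (bch_code (F m) n) \<le> 1"
      using eventually_ge_at_top[of 1] unfolding assms(2)
      by eventually_elim (rule binary_field.code_rate_bch_bounds(1)[OF F assms(1)])
    have "((\<lambda>m. real m / 4 ^ m) \<longlongrightarrow> 0) sequentially"
      by real_asymp
    then show "((\<lambda>m. 1 - (real m / 4 ^ m + real m * (15 / 16) ^ (m div (2 * r)))) \<longlongrightarrow> 1) sequentially"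
      using tendsto_diff[OF tendsto_const tendsto_add[OF _ lim], of _ 0 1] by simp
  qed
  then show "unit_rate_family (bch_indices n)
      (\<lambda>m. carrier (plane (F m))) (\<lambda>m. bch_code (F m) n)"
    \<comment> \<open>Convergence along all \<open>m\<close> passes to the filter restricted to
      \<open>bch_indices n\<close>, which lies below \<open>sequentially\<close>.\<close>
    unfolding unit_rate_family_def by (rule filterlim_mono) simp_all
qed

end
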